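(* Let $\ell\geq1$ be an integer. Suppose that the chain $\Phi$ with (stochastic or sub-stochastic) transition kernel $P$ on $(X,\mathcal{B}(X))$ is $\psi$-irreducible. Then $\Phi$ is $\ell$-transient if there exist a set $A\in\mathcal{B}^{+}(X)$, constants $d\in(0,\infty)$, $b\in(0,1)$, and nonnegative (real-valued, measurable) functions $V,W$ on $X$ with $V(x)\geq1$ for $x\in X$, $W(x)\geq1$ for $x\in A$ and $W(x)\leq1$ for $x\in A^{c}$, satisfying for all $x\in X$ $$\begin{cases} PV(x)\leq\left(V(x)-\ell\,V^{1-\frac{1}{\ell}}(x)\right)1_{A^{c}}(x)+d\,1_{A}(x);\\ PW(x)\leq W(x)1_{A^{c}}(x)+b\,1_{A}(x). \end{cases}$$
   Context: Setting: $\Phi=\{\Phi_n:n\in\mathbb{Z}_+\}$ is a discrete-time homogeneous Markov chain on a general state space $X$ with a countably generated $\sigma$-field $\mathcal{B}(X)$. $P^n(x,A)=\mathbb{P}_x\{\Phi_n\in A\}$ is its $n$-step transition kernel; $P$ may be stochastic or sub-stochastic (in the sub-stochastic case the chain may leave $X$, after which it never returns). For measurable $f\ge 0$, $P^nf(x)=\int_X f(y)P^n(x,dy)$. Irreducibility: $\Phi$ is $\psi$-irreducible, where $\psi$ is a maximal irreducibility measure: $\psi$ is a nontrivial $\sigma$-finite measure such that $\psi(A)>0$ implies that for every $x\in X$ there is $n\ge1$ with $P^n(x,A)>0$, and every other measure with this property is absolutely continuous with respect to $\psi$. $\mathcal{B}^{+}(X)=\{A\in\mathcal{B}(X):\psi(A)>0\}$.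 Algebraic transience: for an integer $\ell\ge1$, a set $A\in\mathcal{B}^{+}(X)$ is uniformly $\ell$-transient if $\sup_{x\in A}\sum_{n=1}^{\infty}n^{\ell}P^{n}(x,A)<\infty$. The chain is $\ell$-transient if it is $\psi$-irreducible and there exist sets $D$ and $A_i$, $i=1,2,\dots$ with $X=D\cup\bigcup_{i=1}^\infty A_i$, $\psi(D)=0$, and each $A_i$ uniformly $\ell$-transient. *)

theory Defs
  imports "HOL-Probability.Probability"
begin

definition countably_generated :: "'a measure \<Rightarrow> bool" where
  "countably_generated M \<longleftrightarrow>
     (\<exists>E. countable E \<and> E \<subseteq> Pow (space M) \<and> sets M = sigma_sets (space M) E)"

(* A stochastic or sub-stochastic transition kernel on the state space M is a function
   P \<in> measurable M (subprob_algebra M). The mass missing from P x is the probability of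
   leaving the state space, never to return, so the n-step kernels are the
   Chapman-Kolmogorov iterates. *)
primrec kernel_power :: "'a measure \<Rightarrow> ('a \<Rightarrow> 'a measure) \<Rightarrow> nat \<Rightarrow> 'a \<Rightarrow> 'a measure" where
  "kernel_power M P 0 = return M"
| "kernel_power M P (Suc n) = (\<lambda>x. kernel_power M P n x \<bind> P)"

lemma measurable_kernel_power:
  assumes "P \<in> measurable M (subprob_algebra M)"
  shows "kernel_power M P n \<in> measurable M (subprob_algebra M)"
  by (induction n) (auto intro: measurable_bind2 assms)

lemma emeasure_kernel_power_Suc:
  assumes P: "P \<in> measurable M (subprob_algebra M)" and x: "x \<in> space M" and A: "A \<in> sets M"
  shows "emeasure (kernel_power M P (Suc n) x) A = (\<integral>\<^sup>+ y. emeasure (P y) A \<partial>kernel_power M P n x)"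
proof -
  have "kernel_power M P n x \<in> space (subprob_algebra M)"
    using measurable_kernel_power[OF P] x by (rule measurable_space)
  then have s: "sets (kernel_power M P n x) = sets M"
    by (simp add: space_subprob_algebra)
  then have "space (kernel_power M P n x) \<noteq> {}"
    using x by (auto dest: sets_eq_imp_space_eq)
  moreover have "P \<in> measurable (kernel_power M P n x) (subprob_algebra M)"
    using P measurable_cong_sets[OF s refl] by blast
  ultimately show ?thesis
    using A by (simp add: emeasure_bind)
qed

definition kernel_fun :: "('a \<Rightarrow> 'a measure) \<Rightarrow> ('a \<Rightarrow> real) \<Rightarrow> 'a \<Rightarrow> ennreal" where
  "kernel_fun P f x = (\<integral>\<^sup>+ y. ennreal (f y) \<partial>P x)"

definition irreducibility_measure ::
  "'a measure \<Rightarrow> ('a \<Rightarrow> 'a measure) \<Rightarrow> 'a measure \<Rightarrow> bool" where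
  "irreducibility_measure M P \<phi> \<longleftrightarrow>
     sets \<phi> = sets M \<and> sigma_finite_measure \<phi> \<and> emeasure \<phi> (space M) > 0 \<and>
     (\<forall>A\<in>sets M. emeasure \<phi> A > 0 \<longrightarrow>
        (\<forall>x\<in>space M. \<exists>n\<ge>1. emeasure (kernel_power M P n x) A > 0))"

(* The argument order of absolutely_continuous: the last conjunct says that \<phi> is
   absolutely continuous with respect to \<psi>. *)
definition psi_irreducible ::
  "'a measure \<Rightarrow> ('a \<Rightarrow> 'a measure) \<Rightarrow> 'a measure \<Rightarrow> bool" where
  "psi_irreducible M P \<psi> \<longleftrightarrow>
     irreducibility_measure M P \<psi> \<and>
     (\<forall>\<phi>. irreducibility_measure M P \<phi> \<longrightarrow> absolutely_continuous \<psi> \<phi>)"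

definition pos_sets :: "'a measure \<Rightarrow> 'a measure \<Rightarrow> 'a set set" where
  "pos_sets M \<psi> = {A \<in> sets M. emeasure \<psi> A > 0}"

definition uniformly_transient ::
  "'a measure \<Rightarrow> ('a \<Rightarrow> 'a measure) \<Rightarrow> 'a measure \<Rightarrow> nat \<Rightarrow> 'a set \<Rightarrow> bool" where
  "uniformly_transient M P \<psi> l A \<longleftrightarrow>
     A \<in> pos_sets M \<psi> \<and>
     (SUP x\<in>A. \<Sum>n. of_nat (Suc n ^ l) * emeasure (kernel_power M P (Suc n) x) A) < (\<infinity>::ennreal)"

definition transient_chain ::
  "'a measure \<Rightarrow> ('a \<Rightarrow> 'a measure) \<Rightarrow> 'a measure \<Rightarrow> nat \<Rightarrow> bool" where
  "transient_chain M P \<psi> l \<longleftrightarrow>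
     psi_irreducible M P \<psi> \<and>
     (\<exists>D A. D \<in> sets M \<and> emeasure \<psi> D = 0 \<and>
        (\<forall>i::nat. uniformly_transient M P \<psi> l (A i)) \<and>
        space M = D \<union> (\<Union>i. A i))"

end

theory Submission
  imports Defs
begin

text \<open>
  Minkowski's inequality in \<open>L\<^sup>l\<close> turns the two drift conditions into a single time-dependent one:
  with \<open>w = W\<^bsup>1/l\<^esup>\<close>, \<open>v = V\<^bsup>1/l\<^esup>\<close> and a large constant \<open>c\<close>, the functions
  \<open>F\<^sub>n = ((n + c) w + v)\<^bsup>l\<^esup>\<close> satisfy \<open>P F\<^sub>n\<^sub>+\<^sub>1 \<le> F\<^sub>n\<close> off \<open>A\<close>, because \<open>w \<le> 1\<close> there and
  the drift lowers \<open>v\<close> by 1 (Bernoulli), while \<open>P F\<^sub>n\<^sub>+\<^sub>1 \<le> \<theta>\<^bsup>l\<^esup> (n + c)\<^bsup>l\<^esup>\<close> with \<open>\<theta> < 1\<close> on \<open>A\<close>,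
  where \<open>F\<^sub>n \<ge> (n + c)\<^bsup>l\<^esup>\<close>.  Telescoping along the chain bounds \<open>\<Sum>n. n\<^bsup>l\<^esup> P\<^bsup>n\<^esup>(x, A)\<close> by a
  finite function of \<open>x\<close> that is constant on \<open>A\<close>; irreducibility then spreads transience from \<open>A\<close>
  to the whole space.
\<close>

section \<open>Minkowski's inequality for integer exponents\<close>

text \<open>Convexity of x^(n+1) on the nonnegative reals, applied to a + b = s * (a / s) + t * (b /
  t) with weights s, t proportional to \<alpha>, \<beta>. Equality holds at a = \<alpha>, b =
  \<beta>, so integrating this pointwise bound gives the sharp constant when \<alpha> and \<beta>
  are norms.\<close>

lemma power_add_le_weighted:
  fixes a b \<alpha> \<beta> :: real
  assumes "0 \<le> a" "0 \<le> b" "0 < \<alpha>" "0 < \<beta>"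
  shows "(a + b) ^ Suc n \<le> (\<alpha> + \<beta>) ^ n * (a ^ Suc n / \<alpha> ^ n + b ^ Suc n / \<beta> ^ n)"
proof -
  define s where "s = \<alpha> / (\<alpha> + \<beta>)"
  define t where "t = \<beta> / (\<alpha> + \<beta>)"
  have st: "s > 0" "t > 0" "s + t = 1"
    using assms by (auto simp: s_def t_def add_divide_distrib[symmetric])
  have "convex_on {0..} (\<lambda>x::real. x ^ Suc n)"
    by (cases "even (Suc n)")
      (blast intro: convex_power_odd convex_on_subset[OF convex_power_even])+
  then have "(s *\<^sub>R (a / s) + t *\<^sub>R (b / t)) ^ Suc n \<le> s * (a / s) ^ Suc n + t * (b / t) ^ Suc n"
    using convex_onD[of "{0..}" "\<lambda>x::real. x ^ Suc n" t "a / s" "b / t"] st assms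
    by (simp del: power_Suc add: eq_diff_eq[THEN iffD2, OF st(3), symmetric])
  also have "s *\<^sub>R (a / s) + t *\<^sub>R (b / t) = a + b"
    using st by simp
  also have "s * (a / s) ^ Suc n = (\<alpha> + \<beta>) ^ n * (a ^ Suc n / \<alpha> ^ n)"
  proof -
    have "s * (a / s) ^ Suc n = a * (a / s) ^ n"
      using st by simp
    also have "\<dots> = a * ((\<alpha> + \<beta>) * a / \<alpha>) ^ n"
      by (simp add: s_def mult.commute)
    also have "\<dots> = (\<alpha> + \<beta>) ^ n * (a ^ Suc n / \<alpha> ^ n)"
      by (simp add: power_divide power_mult_distrib)
    finally show ?thesis .
  qed
  also have "t * (b / t) ^ Suc n = (\<alpha> + \<beta>) ^ n * (b ^ Suc n / \<beta> ^ n)"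
  proof -
    have "t * (b / t) ^ Suc n = b * (b / t) ^ n"
      using st by simp
    also have "\<dots> = b * ((\<alpha> + \<beta>) * b / \<beta>) ^ n"
      by (simp add: t_def mult.commute)
    also have "\<dots> = (\<alpha> + \<beta>) ^ n * (b ^ Suc n / \<beta> ^ n)"
      by (simp add: power_divide power_mult_distrib)
    finally show ?thesis .
  qed
  finally show ?thesis
    by (simp add: distrib_left)
qed

text \<open>Integrating the weighted pointwise bound and inserting the norm bounds \<alpha>, \<beta>
  leaves (\<alpha> + \<beta>)^(p-1) * (\<alpha> + \<beta>). Positivity is what permits dividing by
  powers of \<alpha> and \<beta>.\<close>

lemma nn_integral_Minkowski_pos:
  fixes f g :: "'a \<Rightarrow> real"
  assumes meas [measurable]: "f \<in> borel_measurable N" "g \<in> borel_measurable N"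
    and nonneg: "\<And>x. x \<in> space N \<Longrightarrow> 0 \<le> f x" "\<And>x. x \<in> space N \<Longrightarrow> 0 \<le> g x"
    and pos: "0 < \<alpha>" "0 < \<beta>" and p: "1 \<le> p"
    and f: "(\<integral>\<^sup>+x. ennreal (f x ^ p) \<partial>N) \<le> ennreal (\<alpha> ^ p)"
    and g: "(\<integral>\<^sup>+x. ennreal (g x ^ p) \<partial>N) \<le> ennreal (\<beta> ^ p)"
  shows "(\<integral>\<^sup>+x. ennreal ((f x + g x) ^ p) \<partial>N) \<le> ennreal ((\<alpha> + \<beta>) ^ p)"
proof -
  obtain n where n: "p = Suc n"
    using p by (cases p) auto
  define A where "A = (\<alpha> + \<beta>) ^ n / \<alpha> ^ n"
  define B where "B = (\<alpha> + \<beta>) ^ n / \<beta> ^ n"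
  have AB: "0 \<le> A" "0 \<le> B"
    using pos by (auto simp: A_def B_def)
  have "(\<integral>\<^sup>+x. ennreal ((f x + g x) ^ p) \<partial>N)
      \<le> (\<integral>\<^sup>+x. ennreal A * ennreal (f x ^ p) + ennreal B * ennreal (g x ^ p) \<partial>N)"
  proof (rule nn_integral_mono)
    fix x assume x: "x \<in> space N"
    have "(f x + g x) ^ p \<le> A * f x ^ p + B * g x ^ p"
      using power_add_le_weighted[OF nonneg[OF x] pos, of n]
      by (simp add: n A_def B_def distrib_left)
    then show "ennreal ((f x + g x) ^ p) \<le> ennreal A * ennreal (f x ^ p) + ennreal B * ennreal (g x ^ p)"
      using AB nonneg[OF x] by (simp flip: ennreal_mult ennreal_plus add: ennreal_leI)
  qed
  also have "\<dots> = ennreal A * (\<integral>\<^sup>+x. ennreal (f x ^ p) \<partial>N) + ennreal B * (\<integral>\<^sup>+x. ennreal (g x ^ p) \<partial>N)"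
    by (simp add: nn_integral_add nn_integral_cmult)
  also have "\<dots> \<le> ennreal A * ennreal (\<alpha> ^ p) + ennreal B * ennreal (\<beta> ^ p)"
    by (intro add_mono mult_left_mono f g) auto
  also have "\<dots> = ennreal (A * \<alpha> ^ p + B * \<beta> ^ p)"
    using AB pos by (simp flip: ennreal_mult ennreal_plus)
  also have "A * \<alpha> ^ p + B * \<beta> ^ p = (\<alpha> + \<beta>) ^ p"
    using pos by (simp add: A_def B_def n algebra_simps)
  finally show ?thesis .
qed

text \<open>Limit of the positive case with both bounds enlarged by 1/(n+1). Zero bounds do occur:
  off the set of the drift conditions the bounds will be \<open>w y\<close> and
  \<open>v y - 1\<close>, and either may vanish.\<close>

lemma nn_integral_Minkowski:
  fixes f g :: "'a \<Rightarrow> real"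
  assumes "f \<in> borel_measurable N" "g \<in> borel_measurable N"
    and "\<And>x. x \<in> space N \<Longrightarrow> 0 \<le> f x" "\<And>x. x \<in> space N \<Longrightarrow> 0 \<le> g x"
    and nonneg: "0 \<le> \<alpha>" "0 \<le> \<beta>" and "1 \<le> p"
    and f: "(\<integral>\<^sup>+x. ennreal (f x ^ p) \<partial>N) \<le> ennreal (\<alpha> ^ p)"
    and g: "(\<integral>\<^sup>+x. ennreal (g x ^ p) \<partial>N) \<le> ennreal (\<beta> ^ p)"
  shows "(\<integral>\<^sup>+x. ennreal ((f x + g x) ^ p) \<partial>N) \<le> ennreal ((\<alpha> + \<beta>) ^ p)"
proof (rule LIMSEQ_le_const)
  let ?e = "\<lambda>n. inverse (real (Suc n))"
  have "(\<lambda>n. ((\<alpha> + ?e n) + (\<beta> + ?e n)) ^ p) \<longlonglongrightarrow> ((\<alpha> + 0) + (\<beta> + 0)) ^ p"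
    by (intro tendsto_intros LIMSEQ_inverse_real_of_nat)
  then show "(\<lambda>n. ennreal (((\<alpha> + ?e n) + (\<beta> + ?e n)) ^ p)) \<longlonglongrightarrow> ennreal ((\<alpha> + \<beta>) ^ p)"
    by (intro tendsto_ennrealI) simp
  have "(\<integral>\<^sup>+x. ennreal ((f x + g x) ^ p) \<partial>N) \<le> ennreal (((\<alpha> + ?e n) + (\<beta> + ?e n)) ^ p)" for n
  proof (rule nn_integral_Minkowski_pos)
    show "0 < \<alpha> + ?e n" "0 < \<beta> + ?e n"
      using nonneg by (auto intro: add_nonneg_pos)
    show "(\<integral>\<^sup>+x. ennreal (f x ^ p) \<partial>N) \<le> ennreal ((\<alpha> + ?e n) ^ p)"
      by (rule order_trans[OF f]) (intro ennreal_leI power_mono, use nonneg in auto)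
    show "(\<integral>\<^sup>+x. ennreal (g x ^ p) \<partial>N) \<le> ennreal ((\<beta> + ?e n) ^ p)"
      by (rule order_trans[OF g]) (intro ennreal_leI power_mono, use nonneg in auto)
  qed fact+
  then show "\<exists>N0. \<forall>n\<ge>N0. (\<integral>\<^sup>+x. ennreal ((f x + g x) ^ p) \<partial>N)
      \<le> ennreal (((\<alpha> + ?e n) + (\<beta> + ?e n)) ^ p)"
    by blast
qed

section \<open>The drift of V expressed through its root\<close>

text \<open>With r the l-th root of v, the left side is r^l * (1 - l/r), and Bernoulli's inequality
  bounds it by r^l * (1 - 1/r)^l. Thus the drift condition on V lowers the norm of its root by
  1.\<close>

lemma sub_powr_le_root_power:
  fixes v :: real
  assumes v: "1 \<le> v" and l: "1 \<le> l"
  shows "v - real l * v powr (1 - 1 / real l) \<le> (root l v - 1) ^ l"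
proof -
  define r where "r = root l v"
  have r: "1 \<le> r" "r ^ l = v"
    using v l by (auto simp: r_def real_root_pow_pos2)
  have rl: "r ^ l = r * r ^ (l - 1)"
    using l by (cases l) auto
  have "v powr (1 - 1 / real l) = (r powr real l) powr (1 - 1 / real l)"
    using r by (simp add: powr_realpow)
  also have "\<dots> = r powr real (l - 1)"
    using l by (simp add: powr_powr right_diff_distrib of_nat_diff)
  also have "\<dots> = r ^ (l - 1)"
    using r by (simp add: powr_realpow)
  finally have 1: "v powr (1 - 1 / real l) = r ^ (l - 1)" .
  have "1 + real l * (- 1 / r) \<le> (1 + (- 1 / r)) ^ l"
    by (rule Bernoulli_inequality) (use r in auto)
  then have "r ^ l * (1 + real l * (- 1 / r)) \<le> r ^ l * (1 + (- 1 / r)) ^ l"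
    using r by (intro mult_left_mono) auto
  also have "\<dots> = (r - 1) ^ l"
    using r(1) by (simp only: power_mult_distrib[symmetric]) (simp add: right_diff_distrib)
  also have "r ^ l * (1 + real l * (- 1 / r)) = r ^ l - real l * r ^ (l - 1)"
    using r(1) by (simp add: rl field_simps)
  finally show ?thesis
    using 1 r(2) by (simp add: r_def)
qed

section \<open>Iterated kernels and telescoping\<close>

lemma sets_kernel_power:
  assumes "P \<in> measurable M (subprob_algebra M)" "x \<in> space M"
  shows "sets (kernel_power M P n x) = sets M"
  using measurable_space[OF measurable_kernel_power[OF assms(1)] assms(2)]
  by (simp add: space_subprob_algebra)

lemma nn_integral_kernel_power_Suc:
  assumes P: "P \<in> measurable M (subprob_algebra M)" and x: "x \<in> space M"
    and f: "f \<in> borel_measurable M"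
  shows "(\<integral>\<^sup>+y. f y \<partial>kernel_power M P (Suc n) x) = (\<integral>\<^sup>+y. \<integral>\<^sup>+z. f z \<partial>P y \<partial>kernel_power M P n x)"
proof -
  have "P \<in> measurable (kernel_power M P n x) (subprob_algebra M)"
    using P measurable_cong_sets[OF sets_kernel_power[OF P x] refl] by blast
  with f show ?thesis
    by (simp add: nn_integral_bind[of _ M])
qed

text \<open>The Chapman-Kolmogorov equation, needed because the iterates are defined by appending
  one step at the end.\<close>

lemma kernel_power_add:
  assumes P [measurable]: "P \<in> measurable M (subprob_algebra M)" and x: "x \<in> space M"
    and A: "A \<in> sets M"
  shows "emeasure (kernel_power M P (n + k) x) A
    = (\<integral>\<^sup>+y. emeasure (kernel_power M P k y) A \<partial>kernel_power M P n x)"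
proof -
  note [measurable] = measurable_kernel_power[OF P]
  \<comment> \<open>The induction on \<open>k\<close> runs over all measurable \<open>f\<close>,
    since removing the last step replaces \<open>f\<close> by its integral under
    \<open>P\<close>.\<close>
  have gen: "(\<integral>\<^sup>+y. f y \<partial>kernel_power M P (n + k) x)
      = (\<integral>\<^sup>+y. \<integral>\<^sup>+z. f z \<partial>kernel_power M P k y \<partial>kernel_power M P n x)"
    if "f \<in> borel_measurable M" for f
    using that
  proof (induction k arbitrary: f)
    case 0
    have "(\<integral>\<^sup>+z. f z \<partial>kernel_power M P 0 y) = f y" if "y \<in> space (kernel_power M P n x)" for y
      using that sets_eq_imp_space_eq[OF sets_kernel_power[OF P x]] 0
      by (simp add: nn_integral_return)
    then show ?case
      unfolding add_0_right by (intro nn_integral_cong) (simp only:)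
  next
    case (Suc k)
    have m: "(\<lambda>y. \<integral>\<^sup>+z. f z \<partial>P y) \<in> borel_measurable M"
      using Suc.prems by measurable
    have "(\<integral>\<^sup>+y. f y \<partial>kernel_power M P (n + Suc k) x)
        = (\<integral>\<^sup>+y. \<integral>\<^sup>+z. f z \<partial>P y \<partial>kernel_power M P (n + k) x)"
      using nn_integral_kernel_power_Suc[OF P x Suc.prems, of "n + k"] by simp
    also have "\<dots> = (\<integral>\<^sup>+y. \<integral>\<^sup>+z. \<integral>\<^sup>+w. f w \<partial>P z \<partial>kernel_power M P k y \<partial>kernel_power M P n x)"
      by (rule Suc.IH[OF m])
    also have "\<dots> = (\<integral>\<^sup>+y. \<integral>\<^sup>+z. f z \<partial>kernel_power M P (Suc k) y \<partial>kernel_power M P n x)"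
    proof (rule nn_integral_cong)
      fix y assume "y \<in> space (kernel_power M P n x)"
      then have "y \<in> space M"
        using sets_eq_imp_space_eq[OF sets_kernel_power[OF P x]] by simp
      from nn_integral_kernel_power_Suc[OF P this Suc.prems]
      show "(\<integral>\<^sup>+z. \<integral>\<^sup>+w. f w \<partial>P z \<partial>kernel_power M P k y)
          = (\<integral>\<^sup>+z. f z \<partial>kernel_power M P (Suc k) y)"
        by simp
    qed
    finally show ?case .
  qed
  have "emeasure (kernel_power M P (n + k) x) A = (\<integral>\<^sup>+y. indicator A y \<partial>kernel_power M P (n + k) x)"
    using A by (simp add: sets_kernel_power[OF P x])
  also have "\<dots> = (\<integral>\<^sup>+y. \<integral>\<^sup>+z. indicator A z \<partial>kernel_power M P k y \<partial>kernel_power M P n x)"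
    using A by (intro gen) auto
  also have "\<dots> = (\<integral>\<^sup>+y. emeasure (kernel_power M P k y) A \<partial>kernel_power M P n x)"
  proof (rule nn_integral_cong)
    fix y assume "y \<in> space (kernel_power M P n x)"
    then have "y \<in> space M"
      using sets_eq_imp_space_eq[OF sets_kernel_power[OF P x]] by simp
    then show "(\<integral>\<^sup>+z. indicator A z \<partial>kernel_power M P k y) = emeasure (kernel_power M P k y) A"
      using A by (simp add: sets_kernel_power[OF P])
  qed
  finally show ?thesis .
qed

text \<open>Integrating the drift inequality at time n against the n-step law makes the mean of
  \<open>H n\<close> drop by at least the mean of \<open>g n\<close>; the drops add up to at most
  the initial value.\<close>

lemma suminf_le_of_time_dependent_drift:
  fixes H g :: "nat \<Rightarrow> 'a \<Rightarrow> ennreal"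
  assumes P [measurable]: "P \<in> measurable M (subprob_algebra M)"
    and H: "\<And>n. H n \<in> borel_measurable M" and g: "\<And>n. g n \<in> borel_measurable M"
    and drift: "\<And>n y. y \<in> space M \<Longrightarrow> (\<integral>\<^sup>+z. H (Suc n) z \<partial>P y) + g n y \<le> H n y"
    and x: "x \<in> space M"
  shows "(\<Sum>n. \<integral>\<^sup>+y. g n y \<partial>kernel_power M P n x) \<le> H 0 x"
proof (rule suminf_le_const)
  fix n
  note sets = sets_kernel_power[OF P x]
  note sp = sets_eq_imp_space_eq[OF sets]
  \<comment> \<open>The mean of \<open>H n\<close> stays on the left to carry the induction; it is
    discarded only at the end.\<close>
  have "(\<Sum>k<n. \<integral>\<^sup>+y. g k y \<partial>kernel_power M P k x) + (\<integral>\<^sup>+y. H n y \<partial>kernel_power M P n x) \<le> H 0 x"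
  proof (induction n)
    case 0
    show ?case
      using x H by (simp add: nn_integral_return)
  next
    case (Suc n)
    have m: "(\<lambda>y. \<integral>\<^sup>+z. H (Suc n) z \<partial>P y) \<in> borel_measurable M"
      using H[of "Suc n"] by measurable
    have "(\<integral>\<^sup>+y. H (Suc n) y \<partial>kernel_power M P (Suc n) x) + (\<integral>\<^sup>+y. g n y \<partial>kernel_power M P n x)
        = (\<integral>\<^sup>+y. (\<integral>\<^sup>+z. H (Suc n) z \<partial>P y) + g n y \<partial>kernel_power M P n x)"
      unfolding nn_integral_kernel_power_Suc[OF P x H]
      using m g by (intro nn_integral_add[symmetric]) (simp_all add: measurable_cong_sets[OF sets refl])
    also have "\<dots> \<le> (\<integral>\<^sup>+y. H n y \<partial>kernel_power M P n x)"
      using drift by (intro nn_integral_mono) (simp add: sp)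
    finally have "(\<Sum>k<Suc n. \<integral>\<^sup>+y. g k y \<partial>kernel_power M P k x)
        + (\<integral>\<^sup>+y. H (Suc n) y \<partial>kernel_power M P (Suc n) x)
        \<le> (\<Sum>k<n. \<integral>\<^sup>+y. g k y \<partial>kernel_power M P k x) + (\<integral>\<^sup>+y. H n y \<partial>kernel_power M P n x)"
      by (simp add: add.assoc add.commute[of "\<integral>\<^sup>+y. g n y \<partial>kernel_power M P n x"] add_left_mono
               del: kernel_power.simps)
    with Suc.IH show ?case
      by (rule order_trans[rotated])
  qed
  then show "(\<Sum>k<n. \<integral>\<^sup>+y. g k y \<partial>kernel_power M P k x) \<le> H 0 x"
    by (rule order_trans[rotated]) simp
qed simp

section \<open>Spreading transience from one set to the whole space\<close>

text \<open>A visit to \<open>B\<close> at time n is followed by at least 1/N expected visits to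
  \<open>A\<close> at times n, ..., n + N. So the time spent in \<open>B\<close> is bounded by N
  times a sum of N + 1 shifted copies of the time spent in \<open>A\<close>.\<close>

lemma weighted_suminf_sampled_le:
  fixes N l :: nat
  assumes P [measurable]: "P \<in> measurable M (subprob_algebra M)" and A: "A \<in> sets M"
    and B: "B \<in> sets M" and x: "x \<in> space M"
    and hit: "\<And>y. y \<in> B \<Longrightarrow> 1 \<le> of_nat N * (\<Sum>k\<le>N. emeasure (kernel_power M P k y) A)"
  shows "(\<Sum>n. of_nat (n ^ l) * emeasure (kernel_power M P n x) B)
    \<le> of_nat (N * Suc N) * (\<Sum>n. of_nat (n ^ l) * emeasure (kernel_power M P n x) A)"
proof -
  let ?a = "\<lambda>n. emeasure (kernel_power M P n x) A"
  note [measurable] = measurable_kernel_power[OF P]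
  note sets = sets_kernel_power[OF P x]
  have em: "(\<lambda>y. emeasure (kernel_power M P k y) A) \<in> borel_measurable (kernel_power M P n x)" for k n
    unfolding measurable_cong_sets[OF sets refl] using A by measurable
  have step: "emeasure (kernel_power M P n x) B \<le> of_nat N * (\<Sum>k\<le>N. ?a (n + k))" for n
  proof -
    have "emeasure (kernel_power M P n x) B = (\<integral>\<^sup>+y. indicator B y \<partial>kernel_power M P n x)"
      using B by (simp add: sets)
    also have "\<dots> \<le> (\<integral>\<^sup>+y. of_nat N * (\<Sum>k\<le>N. emeasure (kernel_power M P k y) A) \<partial>kernel_power M P n x)"
      using hit by (intro nn_integral_mono) (auto split: split_indicator)
    also have "\<dots> = of_nat N * (\<Sum>k\<le>N. ?a (n + k))"
      using em by (simp add: nn_integral_cmult nn_integral_sum kernel_power_add[OF P x A])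
    finally show ?thesis .
  qed
  \<comment> \<open>Delaying a visit only raises its weight, as n^l \<le> (n + k)^l; the first k
    terms of the full series are nonnegative.\<close>
  have shift: "(\<Sum>n. of_nat (n ^ l) * ?a (n + k)) \<le> (\<Sum>n. of_nat (n ^ l) * ?a n)" for k
  proof -
    have "(\<Sum>n. of_nat (n ^ l) * ?a (n + k)) \<le> (\<Sum>n. of_nat ((n + k) ^ l) * ?a (n + k))"
      by (intro suminf_le mult_right_mono of_nat_mono power_mono) auto
    also have "\<dots> \<le> (\<Sum>n. of_nat (n ^ l) * ?a n)"
      by (subst (2) suminf_offset[of _ k]) auto
    finally show ?thesis .
  qed
  have "(\<Sum>n. of_nat (n ^ l) * emeasure (kernel_power M P n x) B)
      \<le> (\<Sum>n. of_nat N * (\<Sum>k\<le>N. of_nat (n ^ l) * ?a (n + k)))"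
  proof (intro suminf_le)
    fix n
    have "of_nat (n ^ l) * emeasure (kernel_power M P n x) B
        \<le> of_nat (n ^ l) * (of_nat N * (\<Sum>k\<le>N. ?a (n + k)))"
      by (intro mult_left_mono step) auto
    then show "of_nat (n ^ l) * emeasure (kernel_power M P n x) B
        \<le> of_nat N * (\<Sum>k\<le>N. of_nat (n ^ l) * ?a (n + k))"
      by (simp add: sum_distrib_left mult.left_commute)
  qed auto
  also have "\<dots> = of_nat N * (\<Sum>k\<le>N. \<Sum>n. of_nat (n ^ l) * ?a (n + k))"
    by (simp add: ennreal_suminf_cmult suminf_sum)
  also have "\<dots> \<le> of_nat N * (\<Sum>k\<le>N. \<Sum>n. of_nat (n ^ l) * ?a n)"
    by (intro mult_left_mono sum_mono shift) auto
  also have "\<dots> = of_nat (N * Suc N) * (\<Sum>n. of_nat (n ^ l) * ?a n)"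
    by (simp only: sum_constant card_atMost of_nat_mult mult.assoc)
  finally show ?thesis .
qed

text \<open>The space is exhausted by the sets \<open>B N\<close> on which the potential
  \<open>u\<close> of \<open>A\<close> is at most N and \<open>A\<close> collects at least 1/N
  expected visits within N steps. On each of them the comparison of visits to \<open>B N\<close> and
  to \<open>A\<close> bounds the weighted sum uniformly.\<close>

lemma transient_chainI_finite_potential:
  fixes c :: nat
  assumes l: "l \<ge> 1" and P [measurable]: "P \<in> measurable M (subprob_algebra M)"
    and irr: "psi_irreducible M P \<psi>" and A: "A \<in> pos_sets M \<psi>"
    and fin: "\<And>x. x \<in> space M \<Longrightarrow> (\<Sum>n. of_nat (n ^ l) * emeasure (kernel_power M P n x) A) < \<infinity>"
    and bdd: "\<And>x. x \<in> A \<Longrightarrow> (\<Sum>n. of_nat (n ^ l) * emeasure (kernel_power M P n x) A) \<le> of_nat c"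
  shows "transient_chain M P \<psi> l"
proof -
  define u where "u = (\<lambda>x. \<Sum>n. of_nat (n ^ l) * emeasure (kernel_power M P n x) A)"
  define h where "h = (\<lambda>N x. of_nat N * (\<Sum>k\<le>N. emeasure (kernel_power M P k x) A))"
  define B where "B = (\<lambda>N. {x \<in> space M. u x \<le> of_nat N \<and> 1 \<le> h N x})"
  have A_sets [measurable]: "A \<in> sets M" and A_pos: "emeasure \<psi> A > 0"
    using A by (auto simp: pos_sets_def)
  have \<psi>: "sets \<psi> = sets M"
    and reach: "\<And>x. x \<in> space M \<Longrightarrow> \<exists>n\<ge>1. emeasure (kernel_power M P n x) A > 0"
    using irr A_sets A_pos by (auto simp: psi_irreducible_def irreducibility_measure_def)
  note [measurable] = measurable_kernel_power[OF P]
  have [measurable]: "u \<in> borel_measurable M" "h N \<in> borel_measurable M" for N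
    unfolding u_def h_def by measurable
  have B_sets [measurable]: "B N \<in> sets M" for N
    unfolding B_def by measurable
  \<comment> \<open>This gives \<open>B N\<close> positive measure. The sum in \<open>h\<close>
    starts at time 0 so that a point of \<open>A\<close> already counts itself.\<close>
  have A_sub: "A \<subseteq> B N" if N: "N \<ge> c" "N \<ge> 1" for N
  proof
    fix x assume x: "x \<in> A"
    then have xs: "x \<in> space M"
      using sets.sets_into_space[OF A_sets] by auto
    have "1 = emeasure (kernel_power M P 0 x) A"
      using x by (simp add: emeasure_return)
    also have "\<dots> \<le> (\<Sum>k\<le>N. emeasure (kernel_power M P k x) A)"
      by (rule member_le_sum) auto
    also have "\<dots> = 1 * \<dots>"
      by simp
    also have "\<dots> \<le> h N x"
      unfolding h_def using N by (intro mult_right_mono) (auto simp: of_nat_mono[of 1, simplified])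
    finally have "1 \<le> h N x" .
    moreover have "u x \<le> of_nat N"
      using bdd[OF x] N by (auto simp: u_def intro: order_trans)
    ultimately show "x \<in> B N"
      using xs by (simp add: B_def)
  qed
  have trans: "uniformly_transient M P \<psi> l (B N)" if N: "N \<ge> c" "N \<ge> 1" for N
    unfolding uniformly_transient_def
  proof
    have "emeasure \<psi> A \<le> emeasure \<psi> (B N)"
      using A_sub[OF N] by (intro emeasure_mono) (auto simp: \<psi>)
    then show "B N \<in> pos_sets M \<psi>"
      using A_pos by (auto simp: pos_sets_def)
    have "(\<Sum>n. of_nat (Suc n ^ l) * emeasure (kernel_power M P (Suc n) x) (B N))
        \<le> of_nat (N * Suc N) * of_nat N" if x: "x \<in> B N" for x
    proof -
      have xs: "x \<in> space M" and ux: "u x \<le> of_nat N"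
        using x by (auto simp: B_def)
      have "(\<Sum>n. of_nat (Suc n ^ l) * emeasure (kernel_power M P (Suc n) x) (B N))
          \<le> (\<Sum>n. of_nat (n ^ l) * emeasure (kernel_power M P n x) (B N))"
        by (subst (2) suminf_offset[of _ 1]) (auto simp del: kernel_power.simps)
      also have "\<dots> \<le> of_nat (N * Suc N) * u x"
        unfolding u_def
        by (rule weighted_suminf_sampled_le[OF P A_sets B_sets xs]) (simp add: B_def h_def)
      also have "\<dots> \<le> of_nat (N * Suc N) * of_nat N"
        by (intro mult_left_mono ux) auto
      finally show ?thesis .
    qed
    then have "(SUP x\<in>B N. \<Sum>n. of_nat (Suc n ^ l) * emeasure (kernel_power M P (Suc n) x) (B N))
        \<le> of_nat (N * Suc N) * of_nat N"
      by (intro SUP_least)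
    also have "\<dots> < (\<infinity>::ennreal)"
      by (simp only: of_nat_mult[symmetric] of_nat_less_top infinity_ennreal_def)
    finally show "(SUP x\<in>B N. \<Sum>n. of_nat (Suc n ^ l) * emeasure (kernel_power M P (Suc n) x) (B N))
        < (\<infinity>::ennreal)" .
  qed
  have cover: "\<exists>i. x \<in> B (i + c + 1)" if x: "x \<in> space M" for x
  proof -
    obtain n where n: "emeasure (kernel_power M P n x) A > 0"
      using reach[OF x] by auto
    \<comment> \<open>The minimum with 1 makes \<open>e\<close> finite, so that 1/e < j can be
      turned into 1 < j * e.\<close>
    define e where "e = min 1 (emeasure (kernel_power M P n x) A)"
    have e: "0 < e" "e < \<infinity>"
      using n by (auto simp: e_def min_less_iff_disj)
    obtain i where i: "u x < of_nat i"
      using fin[OF x] ennreal_Ex_less_of_nat[of "u x"] by (auto simp: u_def)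
    obtain j where "1 / e < of_nat j"
      using e ennreal_Ex_less_of_nat[of "1 / e"]
      by (auto simp: less_top[symmetric] ennreal_divide_eq_top_iff)
    then have j: "1 < of_nat j * e"
      using e by (simp add: divide_less_ennreal)
    \<comment> \<open>Large enough for the potential (\<open>i\<close>), for the inverse hitting
      probability (\<open>j\<close>) and for the hitting time (\<open>n\<close>). The offset
      \<open>c + 1\<close> keeps every index in the range where \<open>B\<close> is known to be
      uniformly transient.\<close>
    define N where "N = (i + j + n) + c + 1"
    have "1 \<le> of_nat j * e"
      using j by simp
    also have "\<dots> \<le> of_nat N * emeasure (kernel_power M P n x) A"
      by (intro mult_mono of_nat_mono) (auto simp: N_def e_def)
    also have "\<dots> \<le> h N x"
      unfolding h_def by (intro mult_left_mono member_le_sum) (auto simp: N_def)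
    finally have "1 \<le> h N x" .
    moreover have "u x \<le> of_nat N"
      by (rule order_trans[OF less_imp_le[OF i]]) (intro of_nat_mono, simp add: N_def)
    ultimately have "x \<in> B N"
      using x by (simp add: B_def)
    then show ?thesis
      unfolding N_def by blast
  qed
  have "B N \<subseteq> space M" for N
    by (auto simp: B_def)
  then have "space M = {} \<union> (\<Union>i. B (i + c + 1))"
    using cover by blast
  then show ?thesis
    unfolding transient_chain_def
    using irr trans by (intro conjI exI[of _ "{}"] exI[of _ "\<lambda>i. B (i + c + 1)"] allI) simp_all
qed

section \<open>From the two drift conditions to a potential bounded on A\<close>

theorem theorem3p6:
  fixes M :: "'a measure" and P :: "'a \<Rightarrow> 'a measure" and \<psi> :: "'a measure" and l :: nat
  assumes "l \<ge> 1"
    and "countably_generated M"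
    and "P \<in> measurable M (subprob_algebra M)"
    and "psi_irreducible M P \<psi>"
    and "\<exists>A \<in> pos_sets M \<psi>. \<exists>(d::real) (b::real) (V::'a \<Rightarrow> real) (W::'a \<Rightarrow> real).
      0 < d \<and> 0 < b \<and> b < 1 \<and>
      V \<in> borel_measurable M \<and> W \<in> borel_measurable M \<and>
      (\<forall>x\<in>space M. 0 \<le> V x \<and> 0 \<le> W x) \<and>
      (\<forall>x\<in>space M. 1 \<le> V x) \<and>
      (\<forall>x\<in>A. 1 \<le> W x) \<and> (\<forall>x\<in>space M - A. W x \<le> 1) \<and>
      (\<forall>x\<in>space M.
         enn2ereal (kernel_fun P V x) \<le>
           ereal ((V x - real l * V x powr (1 - 1 / real l)) * indicator (space M - A) x
                  + d * indicator A x) \<and>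
         enn2ereal (kernel_fun P W x) \<le>
           ereal (W x * indicator (space M - A) x + b * indicator A x))"
  shows "transient_chain M P \<psi> l"
proof -
  note P [measurable] = assms(3)
  obtain A d b V W where A: "A \<in> pos_sets M \<psi>" and d: "0 < d" and b: "0 < b" "b < 1"
    and [measurable]: "V \<in> borel_measurable M" "W \<in> borel_measurable M"
    and VW0: "\<forall>x\<in>space M. 0 \<le> V x \<and> 0 \<le> W x" and V1': "\<forall>x\<in>space M. 1 \<le> V x"
    and WA': "\<forall>x\<in>A. 1 \<le> W x" and WAc': "\<forall>x\<in>space M - A. W x \<le> 1"
    and PVW: "\<forall>x\<in>space M.
         enn2ereal (kernel_fun P V x) \<le>
           ereal ((V x - real l * V x powr (1 - 1 / real l)) * indicator (space M - A) x
                  + d * indicator A x) \<and>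
         enn2ereal (kernel_fun P W x) \<le>
           ereal (W x * indicator (space M - A) x + b * indicator A x)"
    using assms(5) by (elim bexE exE conjE) (rule that, assumption+)
  note W0 = VW0[THEN bspec, THEN conjunct2] and V1 = V1'[THEN bspec]
    and WA = WA'[THEN bspec] and WAc = WAc'[THEN bspec]
    and PV = PVW[THEN bspec, THEN conjunct1] and PW = PVW[THEN bspec, THEN conjunct2]
  have [measurable]: "A \<in> sets M"
    using A by (simp add: pos_sets_def)
  have AM: "x \<in> space M" if "x \<in> A" for x
    using that sets.sets_into_space[of A M] by auto
  \<comment> \<open>The drift bounds contain a subtraction and are stated in \<open>ereal\<close>;
    in \<open>ennreal\<close> a negative right side would be read as 0.\<close>
  have e2e: "t \<le> ennreal r" if "enn2ereal t \<le> ereal r" for t r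
    using e2ennreal_mono[OF that] by simp

  define w v where "w = (\<lambda>x. root l (W x))" and "v = (\<lambda>x. root l (V x))"
  define q \<delta> where "q = root l b" and "\<delta> = root l d"
  \<comment> \<open>\<theta> is the midpoint of q and 1, and c solves (1 - q) * c = 2 * (q +
    \<delta>). Then (n + 1 + c) * q + \<delta> = \<theta> * c + n * q \<le> \<theta> * (n + c),
    which is the contraction on \<open>A\<close>.\<close>
  define \<theta> where "\<theta> = (1 + q) / 2"
  define c where "c = 2 * (q + \<delta>) / (1 - q)"
  have l0: "0 < l"
    using assms(1) by simp
  have q: "0 < q" "q < 1" and \<delta>: "0 < \<delta>" and \<theta>: "0 < \<theta>" "\<theta> < 1"
    using l0 b d by (auto simp: q_def \<delta>_def \<theta>_def real_root_lt_1_iff add_pos_pos)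
  have c: "0 < c"
    using q \<delta> by (auto simp: c_def intro!: divide_pos_pos)
  have w_pow: "w x ^ l = W x" and w0: "0 \<le> w x" if "x \<in> space M" for x
    using W0[OF that] l0 by (auto simp: w_def real_root_pow_pos2)
  have v_pow: "v x ^ l = V x" and v1: "1 \<le> v x" if "x \<in> space M" for x
    using V1[OF that] l0 by (auto simp: v_def real_root_pow_pos2)
  have [measurable]: "w \<in> borel_measurable M" "v \<in> borel_measurable M"
    unfolding w_def v_def by measurable

  \<comment> \<open>Since w^l = W and v^l = V, the bounds on \<open>kernel_fun\<close> are bounds on
    norms of \<open>w\<close> and \<open>v\<close> under \<open>P x\<close>. The factor
    \<open>s\<close> will be the shifted time n + 1 + c.\<close>
  have Mink: "(\<integral>\<^sup>+y. ennreal ((s * w y + v y) ^ l) \<partial>P x) \<le> ennreal ((s * \<alpha> + \<beta>) ^ l)"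
    if x: "x \<in> space M" and s: "0 \<le> s" and \<alpha>: "0 \<le> \<alpha>" and \<beta>: "0 \<le> \<beta>"
      and "kernel_fun P W x \<le> ennreal (\<alpha> ^ l)" "kernel_fun P V x \<le> ennreal (\<beta> ^ l)" for x s \<alpha> \<beta>
  proof (rule nn_integral_Minkowski)
    have sets: "sets (P x) = sets M"
      using measurable_space[OF P x] by (simp add: space_subprob_algebra)
    note sp = sets_eq_imp_space_eq[OF sets]
    show "(\<lambda>y. s * w y) \<in> borel_measurable (P x)" "v \<in> borel_measurable (P x)"
      unfolding measurable_cong_sets[OF sets refl] by measurable
    show "0 \<le> s * w y" "0 \<le> v y" if "y \<in> space (P x)" for y
      using that s w0 v1[of y] by (auto simp: sp)
    have "(\<integral>\<^sup>+y. ennreal ((s * w y) ^ l) \<partial>P x) = (\<integral>\<^sup>+y. ennreal (s ^ l) * ennreal (W y) \<partial>P x)"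
      using s W0 by (intro nn_integral_cong) (simp add: sp power_mult_distrib w_pow ennreal_mult)
    also have "\<dots> = ennreal (s ^ l) * kernel_fun P W x"
      unfolding kernel_fun_def
      by (intro nn_integral_cmult) (simp add: measurable_cong_sets[OF sets refl])
    also have "\<dots> \<le> ennreal (s ^ l) * ennreal (\<alpha> ^ l)"
      by (intro mult_left_mono that) auto
    also have "\<dots> = ennreal ((s * \<alpha>) ^ l)"
      using s \<alpha> by (simp add: ennreal_mult power_mult_distrib)
    finally show "(\<integral>\<^sup>+y. ennreal ((s * w y) ^ l) \<partial>P x) \<le> ennreal ((s * \<alpha>) ^ l)" .
    have "(\<integral>\<^sup>+y. ennreal (v y ^ l) \<partial>P x) = kernel_fun P V x"
      unfolding kernel_fun_def by (intro nn_integral_cong) (simp add: sp v_pow)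
    then show "(\<integral>\<^sup>+y. ennreal (v y ^ l) \<partial>P x) \<le> ennreal (\<beta> ^ l)"
      using that by simp
  qed (use s \<alpha> \<beta> assms(1) in auto)

  \<comment> \<open>On \<open>A\<close>, where V and W may be unbounded, the function is lowered to
    its lower bound there. This makes \<open>h 0\<close> constant on \<open>A\<close>, and lowering
    it under the integral is harmless.\<close>
  define h where "h = (\<lambda>n x. if x \<in> A then (real n + c) ^ l else ((real n + c) * w x + v x) ^ l)"
  have h_le: "h n x \<le> ((real n + c) * w x + v x) ^ l" if x: "x \<in> space M" for n x
  proof (cases "x \<in> A")
    case True
    have "1 \<le> w x"
      using WA[OF True] l0 by (simp add: w_def)
    then have "(real n + c) * 1 \<le> (real n + c) * w x"
      using c by (intro mult_left_mono) auto
    then have "real n + c \<le> (real n + c) * w x + v x"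
      using v1[OF x] by simp
    then show ?thesis
      using True c by (auto simp: h_def intro!: power_mono)
  qed (simp add: h_def)
  \<comment> \<open>The gain on \<open>A\<close> is (1 - \<theta>) * (n + c)^l, of which only (1 -
    \<theta>) * n^l is retained.\<close>
  have drift: "(\<integral>\<^sup>+z. ennreal (h (Suc n) z) \<partial>P y)
      + ennreal (1 - \<theta>) * (of_nat (n ^ l) * indicator A y) \<le> ennreal (h n y)"
    if y: "y \<in> space M" for n y
  proof -
    have sp: "space (P y) = space M"
      using measurable_space[OF P y] by (auto simp: space_subprob_algebra dest: sets_eq_imp_space_eq)
    have "(\<integral>\<^sup>+z. ennreal (h (Suc n) z) \<partial>P y)
        \<le> (\<integral>\<^sup>+z. ennreal (((real (Suc n) + c) * w z + v z) ^ l) \<partial>P y)"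
      by (intro nn_integral_mono ennreal_leI h_le) (simp add: sp)
    note up = order_trans[OF this Mink[OF y]]
    show ?thesis
    proof (cases "y \<in> A")
      case True
      have "(\<integral>\<^sup>+z. ennreal (h (Suc n) z) \<partial>P y) \<le> ennreal (((real (Suc n) + c) * q + \<delta>) ^ l)"
      proof (rule up)
        show "kernel_fun P W y \<le> ennreal (q ^ l)" "kernel_fun P V y \<le> ennreal (\<delta> ^ l)"
          using e2e[OF PW[OF y]] e2e[OF PV[OF y]] True b d l0
          by (auto simp: q_def \<delta>_def real_root_pow_pos2)
      qed (use c q \<delta> in auto)
      also have "\<dots> \<le> ennreal (\<theta> * (real n + c) ^ l)"
      proof (rule ennreal_leI)
        have "q \<le> \<theta>"
          using q by (simp add: \<theta>_def)
        have "(1 - q) * c = 2 * (q + \<delta>)"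
          using q by (simp add: c_def)
        then have "(real (Suc n) + c) * q + \<delta> = \<theta> * c + real n * q"
          by (simp add: \<theta>_def algebra_simps)
        also have "\<dots> \<le> \<theta> * (real n + c)"
          using mult_right_mono[of q \<theta> "real n"] q
          \<open>q \<le> \<theta>\<close> by (simp add: distrib_left mult.commute[of "real n"])
        finally have "((real (Suc n) + c) * q + \<delta>) ^ l \<le> (\<theta> * (real n + c)) ^ l"
          using c q \<delta> by (intro power_mono) auto
        \<comment> \<open>Here \<theta>^l \<le> \<theta>, because \<theta> < 1 and l is at least
          1.\<close>
        also have "\<dots> \<le> \<theta> * (real n + c) ^ l"
          using \<theta> c l0 power_decreasing[of 1 l \<theta>]
          by (auto simp: power_mult_distrib intro!: mult_right_mono)
        finally show "((real (Suc n) + c) * q + \<delta>) ^ l \<le> \<theta> * (real n + c) ^ l" .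
      qed
      finally have "(\<integral>\<^sup>+z. ennreal (h (Suc n) z) \<partial>P y)
          + ennreal (1 - \<theta>) * (of_nat (n ^ l) * indicator A y)
          \<le> ennreal (\<theta> * (real n + c) ^ l) + ennreal (1 - \<theta>) * ennreal (real (n ^ l))"
        using True by (intro add_mono) (auto simp: ennreal_of_nat_eq_real_of_nat)
      also have "\<dots> = ennreal (\<theta> * (real n + c) ^ l + (1 - \<theta>) * real (n ^ l))"
        using \<theta> c by (simp flip: ennreal_mult ennreal_plus)
      also have "\<dots> \<le> ennreal (\<theta> * (real n + c) ^ l + (1 - \<theta>) * (real n + c) ^ l)"
        using \<theta> c by (intro ennreal_leI add_left_mono mult_left_mono) (auto intro!: power_mono)
      also have "\<dots> = ennreal (h n y)"
        using True by (simp add: h_def algebra_simps)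
      finally show ?thesis .
    next
      case False
      have "(\<integral>\<^sup>+z. ennreal (h (Suc n) z) \<partial>P y) \<le> ennreal (((real (Suc n) + c) * w y + (v y - 1)) ^ l)"
      proof (rule up)
        show "kernel_fun P W y \<le> ennreal (w y ^ l)"
          using e2e[OF PW[OF y]] False y by (simp add: w_pow)
        have "kernel_fun P V y \<le> ennreal (V y - real l * V y powr (1 - 1 / real l))"
          using e2e[OF PV[OF y]] False y by simp
        also have "\<dots> \<le> ennreal ((v y - 1) ^ l)"
          unfolding v_def by (intro ennreal_leI sub_powr_le_root_power V1 y assms(1))
        finally show "kernel_fun P V y \<le> ennreal ((v y - 1) ^ l)" .
      qed (use c w0[OF y] v1[OF y] in auto)
      also have "\<dots> \<le> ennreal (h n y)"
      proof -
        have "w y \<le> 1"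
          using WAc[of y] y False l0 by (simp add: w_def)
        \<comment> \<open>Advancing the time adds one \<open>w y\<close>, at most 1, and the drop of
          1 in \<open>v\<close> pays for it.\<close>
        then have "((real (Suc n) + c) * w y + (v y - 1)) ^ l \<le> ((real n + c) * w y + v y) ^ l"
          using c w0[OF y] v1[OF y] by (intro power_mono add_nonneg_nonneg mult_nonneg_nonneg)
            (auto simp: algebra_simps)
        then show ?thesis
          using False by (auto simp: h_def intro: ennreal_leI)
      qed
      finally show ?thesis
        using False by simp
    qed
  qed

  have pot: "(\<Sum>n. of_nat (n ^ l) * emeasure (kernel_power M P n x) A) \<le> ennreal (h 0 x / (1 - \<theta>))"
    if x: "x \<in> space M" for x
  proof -
    let ?u = "\<Sum>n. of_nat (n ^ l) * emeasure (kernel_power M P n x) A"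
    have "(\<Sum>n. \<integral>\<^sup>+y. ennreal (1 - \<theta>) * (of_nat (n ^ l) * indicator A y) \<partial>kernel_power M P n x)
        \<le> ennreal (h 0 x)"
      by (rule suminf_le_of_time_dependent_drift[where H = "\<lambda>n y. ennreal (h n y)", OF P _ _ drift x])
        (auto simp: h_def)
    moreover have "(\<integral>\<^sup>+y. ennreal (1 - \<theta>) * (of_nat (n ^ l) * indicator A y) \<partial>kernel_power M P n x)
        = ennreal (1 - \<theta>) * (of_nat (n ^ l) * emeasure (kernel_power M P n x) A)" for n
    proof -
      have [measurable]: "A \<in> sets (kernel_power M P n x)"
        by (simp add: sets_kernel_power[OF P x])
      show ?thesis
        by (simp add: nn_integral_cmult nn_integral_cmult_indicator)
    qed
    ultimately have "ennreal (1 - \<theta>) * ?u \<le> ennreal (h 0 x)"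
      by simp
    then have "ennreal (1 / (1 - \<theta>)) * (ennreal (1 - \<theta>) * ?u) \<le> ennreal (1 / (1 - \<theta>)) * ennreal (h 0 x)"
      by (rule mult_left_mono) simp
    also have "ennreal (1 / (1 - \<theta>)) * (ennreal (1 - \<theta>) * ?u) = ?u"
      using \<theta> by (simp flip: mult.assoc ennreal_mult)
    also have "ennreal (1 / (1 - \<theta>)) * ennreal (h 0 x) = ennreal (h 0 x / (1 - \<theta>))"
      using \<theta> by (simp flip: ennreal_mult')
    finally show ?thesis .
  qed
  show ?thesis
  proof (rule transient_chainI_finite_potential[OF assms(1) P assms(4) A])
    show "(\<Sum>n. of_nat (n ^ l) * emeasure (kernel_power M P n x) A) < \<infinity>" if "x \<in> space M" for x
      using pot[OF that] by (rule order.strict_trans1) simp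
    \<comment> \<open>On \<open>A\<close> the value of \<open>h 0\<close> is c^l; rounding up
      supplies the natural number that indexes the sets \<open>B N\<close>.\<close>
    show "(\<Sum>n. of_nat (n ^ l) * emeasure (kernel_power M P n x) A) \<le> of_nat (nat \<lceil>c ^ l / (1 - \<theta>)\<rceil>)"
      if "x \<in> A" for x
    proof -
      have "ennreal (h 0 x / (1 - \<theta>)) \<le> of_nat (nat \<lceil>c ^ l / (1 - \<theta>)\<rceil>)"
        using that unfolding ennreal_of_nat_eq_real_of_nat
        by (intro ennreal_leI) (simp add: h_def real_nat_ceiling_ge)
      with pot[OF AM[OF that]] show ?thesis
        by (rule order_trans)
    qed
  qed
qed

end
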